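(* Let $G$ be a finitely generated semigroup with finite set of generators $G_1$, and let $G\times X\to X$ be a continuous semigroup action on a compact metric space $X$. If $G\times X\to X$ satisfies the strong orbital specification property, then $h_{top}((G,G_1),X)>0$. In consequence, $h((G,G_1),X)>0$.
   Context: Setting: $G$ is a semigroup with identity $id$ and finite generating set $G_1$ containing $id$; $G_1^*=G_1\setminus\{id\}$ and $m=|G_1^*|$. A continuous action on $X$ assigns to every $g\in G$ a continuous map $g:X\to X$, with $id$ acting as the identity and products acting as compositions. $G_n$ is the set of elements $g_{i_n}\cdots g_{i_1}$ with all $g_{i_j}\in G_1$; $G_n^*$ is the set of elements $g_{i_n}\cdots g_{i_1}$ with all $g_{i_j}\in G_1^*$. Strong orbital specification property: for every $\varepsilon>0$ there is $p(\varepsilon)>0$ such that for any $k\ge1$, any $\underline h_{p_j}\in G^*_{p_j}$ with $p_j\ge p(\varepsilon)$ ($1\le j\le k$), any points $x_1,\dots,x_k\in X$, any natural numbers $n_1,\dots,n_k$ and any concatenations $\underline g_{n_j,j}=g_{i_{n_j},j}\cdots g_{i_2,j}g_{i_1,j}$ of $n_j$ elements of $G_1$ ($1\le j\le k$), there is $x\in X$ such that $d(\underline g_{\ell,1}(x),\underline g_{\ell,1}(x_1))<\varepsilon$ for $\ell=1,\dots,n_1$ and $d(\underline g_{\ell,j}\,\underline h_{p_{j-1}}\cdots\underline g_{n_2,2}\,\underline h_{p_1}\,\underline g_{n_1,1}(x),\underline g_{\ell,j}(x_j))<\varepsilon$ for $j=2,\dots,k$ and $\ell=1,\dots,n_j$,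 where $\underline g_{\ell,j}:=g_{i_\ell,j}\cdots g_{i_1,j}$. Topological entropy $h_{top}$: for a concatenation $\underline g=g_{i_n}\cdots g_{i_1}$ of generators put $\underline g_0=id$, $\underline g_j=g_{i_j}\cdots g_{i_1}$ and $d_{\underline g}(x,y)=\max_{0\le j\le n}d(\underline g_j(x),\underline g_j(y))$ (this depends on the concatenation). Let $s(\underline g,n,\varepsilon)$ be the maximal cardinality of a set $K\subset X$ with $d_{\underline g}(x_1,x_2)>\varepsilon$ for all distinct $x_1,x_2\in K$. Then $h_{top}((G,G_1),X)=\lim_{\varepsilon\to0}\limsup_{n\to\infty}\frac1n\log\Big(\frac1{m^n}\sum_{\underline g}s(\underline g,n,\varepsilon)\Big)$, the sum being over all $m^n$ concatenations $\underline g$ of $n$ elements of $G_1^*$. Entropy $h$: points $x,y$ are $(n,\varepsilon)$-separated by $G$ if there is $g\in G_n$ with $d(g(x),g(y))\ge\varepsilon$; $s(n,\varepsilon,X)$ is the maximal cardinality of a subset of $X$ whose distinct points are pairwise $(n,\varepsilon)$-separated, and $h((G,G_1),X)=\lim_{\varepsilon\to0}\limsup_{n\to\infty}\frac1n\log s(n,\varepsilon,X)$.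
   Formalization: It is additionally assumed that X has at least two points and that G_1 contains a generator other than id; for a one-point X specification holds with both entropies 0, and for G_1={id} it is vacuous while h=0 and h_top is undefined. *)

theory Defs
  imports "HOL-Analysis.Analysis"
begin

text \<open>
  The semigroup with identity is the type \<open>'g :: monoid_mult\<close>; its identity is \<open>1\<close>.  The set
  \<open>G1\<^sup>*\<close> of generators other than the identity is \<open>G1 - {1}\<close>.

  A concatenation \<open>g\<^sub>n \<cdots> g\<^sub>1\<close> of generators is a list in order of application, so its head is
  \<open>g\<^sub>1\<close>, and \<open>take j w\<close> represents the partial concatenation \<open>g\<^sub>j \<cdots> g\<^sub>1\<close>.  Different lists may
  represent the same element.
\<close>

definition concats :: "'g set \<Rightarrow> nat \<Rightarrow> 'g list set" where
  "concats A n = {w. set w \<subseteq> A \<and> length w = n}"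

definition concat_elem :: "'g::monoid_mult list \<Rightarrow> 'g" where
  "concat_elem w = prod_list (rev w)"

definition gen_ball :: "'g::monoid_mult set \<Rightarrow> nat \<Rightarrow> 'g set" where
  "gen_ball G1 n = concat_elem ` concats G1 n"

definition gen_star :: "'g::monoid_mult set \<Rightarrow> nat \<Rightarrow> 'g set" where
  "gen_star G1 n = concat_elem ` concats (G1 - {1}) n"

definition finite_generating_set :: "'g::monoid_mult set \<Rightarrow> bool" where
  "finite_generating_set G1 \<longleftrightarrow> finite G1 \<and> 1 \<in> G1 \<and> (\<Union>n. gen_ball G1 n) = UNIV"

definition continuous_semigroup_action ::
    "('g::monoid_mult \<Rightarrow> 'a::metric_space \<Rightarrow> 'a) \<Rightarrow> 'a set \<Rightarrow> bool" where
  "continuous_semigroup_action act X \<longleftrightarrow>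
     (\<forall>g. act g \<in> X \<rightarrow> X \<and> continuous_on X (act g)) \<and>
     (\<forall>x\<in>X. act 1 x = x) \<and>
     (\<forall>g h. \<forall>x\<in>X. act (g * h) x = act g (act h x))"

text \<open>
  With blocks numbered from 1, the element \<open>(h\<^sub>j\<^sub>-\<^sub>1 g\<^sub>j\<^sub>-\<^sub>1) \<cdots> (h\<^sub>1 g\<^sub>1)\<close> applied before the \<open>j\<close>-th
  block, where \<open>g\<^sub>i\<close> is represented by \<open>w i\<close>; it is \<open>1\<close> for \<open>j = 1\<close>.
\<close>

definition transit :: "(nat \<Rightarrow> 'g::monoid_mult) \<Rightarrow> (nat \<Rightarrow> 'g list) \<Rightarrow> nat \<Rightarrow> 'g" where
  "transit h w j = prod_list (rev (map (\<lambda>i. h i * concat_elem (w i)) [1..<j]))"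

definition strong_orbital_specification ::
    "'g::monoid_mult set \<Rightarrow> ('g \<Rightarrow> 'a::metric_space \<Rightarrow> 'a) \<Rightarrow> 'a set \<Rightarrow> bool" where
  "strong_orbital_specification G1 act X \<longleftrightarrow>
     (\<forall>\<epsilon>>0. \<exists>p\<^sub>0::nat. p\<^sub>0 > 0 \<and>
       (\<forall>(k::nat) (p :: nat \<Rightarrow> nat) (h :: nat \<Rightarrow> 'g) (xs :: nat \<Rightarrow> 'a)
          (n :: nat \<Rightarrow> nat) (w :: nat \<Rightarrow> 'g list).
          k \<ge> 1 \<longrightarrow>
          (\<forall>j\<in>{1..k}. p j \<ge> p\<^sub>0 \<and> h j \<in> gen_star G1 (p j)) \<longrightarrow>
          (\<forall>j\<in>{1..k}. xs j \<in> X) \<longrightarrow>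
          (\<forall>j\<in>{1..k}. n j \<ge> 1 \<and> w j \<in> concats G1 (n j)) \<longrightarrow>
          (\<exists>x\<in>X. \<forall>j\<in>{1..k}. \<forall>l\<in>{1..n j}.
             dist (act (concat_elem (take l (w j)) * transit h w j) x)
                  (act (concat_elem (take l (w j))) (xs j)) < \<epsilon>)))"

definition concat_dist ::
    "('g::monoid_mult \<Rightarrow> 'a::metric_space \<Rightarrow> 'a) \<Rightarrow> 'g list \<Rightarrow> 'a \<Rightarrow> 'a \<Rightarrow> real" where
  "concat_dist act w x y =
     Max ((\<lambda>j. dist (act (concat_elem (take j w)) x) (act (concat_elem (take j w)) y))
          ` {0..length w})"

text \<open>
  On a compact \<open>X\<close> with a continuous action, the cardinalities of the separated sets below are
  bounded, so both uses of \<open>Max\<close> are over finite (and nonempty) sets.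
\<close>

definition sep_along ::
    "('g::monoid_mult \<Rightarrow> 'a::metric_space \<Rightarrow> 'a) \<Rightarrow> 'a set \<Rightarrow> 'g list \<Rightarrow> real \<Rightarrow> nat" where
  "sep_along act X w \<epsilon> =
     Max {card K |K. K \<subseteq> X \<and> finite K \<and>
                     (\<forall>x\<in>K. \<forall>y\<in>K. x \<noteq> y \<longrightarrow> concat_dist act w x y > \<epsilon>)}"

text \<open>
  Both entropies may be infinite.  The limits for \<open>\<epsilon> \<rightarrow> 0\<close> exist in the extended reals, since
  the expressions under them increase as \<open>\<epsilon>\<close> decreases.
\<close>

definition h_top ::
    "'g::monoid_mult set \<Rightarrow> ('g \<Rightarrow> 'a::metric_space \<Rightarrow> 'a) \<Rightarrow> 'a set \<Rightarrow> ereal" where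
  "h_top G1 act X =
     Lim (at_right 0) (\<lambda>\<epsilon>::real. limsup (\<lambda>n::nat. ereal
       (1 / real n * ln (1 / real (card (G1 - {1})) ^ n *
          (\<Sum>w\<in>concats (G1 - {1}) n. real (sep_along act X w \<epsilon>))))))"

definition separated_by ::
    "'g::monoid_mult set \<Rightarrow> ('g \<Rightarrow> 'a::metric_space \<Rightarrow> 'a) \<Rightarrow> nat \<Rightarrow> real \<Rightarrow> 'a \<Rightarrow> 'a \<Rightarrow> bool" where
  "separated_by G1 act n \<epsilon> x y \<longleftrightarrow> (\<exists>g\<in>gen_ball G1 n. dist (act g x) (act g y) \<ge> \<epsilon>)"

definition sep_all ::
    "'g::monoid_mult set \<Rightarrow> ('g \<Rightarrow> 'a::metric_space \<Rightarrow> 'a) \<Rightarrow> nat \<Rightarrow> real \<Rightarrow> 'a set \<Rightarrow> nat" where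
  "sep_all G1 act n \<epsilon> X =
     Max {card K |K. K \<subseteq> X \<and> finite K \<and>
                     (\<forall>x\<in>K. \<forall>y\<in>K. x \<noteq> y \<longrightarrow> separated_by G1 act n \<epsilon> x y)}"

definition h_ent ::
    "'g::monoid_mult set \<Rightarrow> ('g \<Rightarrow> 'a::metric_space \<Rightarrow> 'a) \<Rightarrow> 'a set \<Rightarrow> ereal" where
  "h_ent G1 act X =
     Lim (at_right 0) (\<lambda>\<epsilon>::real. limsup (\<lambda>n::nat. ereal
       (1 / real n * ln (real (sep_all G1 act n \<epsilon> X)))))"

end

theory Submission
  imports Defs
begin

text \<open>
  Since the identity is a generator, the specification property may be applied with all blocks equal
  to the identity.  Cut a word of length \<open>n\<close> into pieces of length \<open>p\<close> and use the pieces as the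
  transition elements: every itinerary in \<open>{a, b}\<close> at the times \<open>0, p, 2 p, \<dots>\<close> along the word is
  then shadowed, which produces \<open>2 ^ (n div p)\<close> points separated along the word.  The gap \<open>p\<close> does
  not depend on \<open>n\<close> or on the word, so both entropies are at least \<open>ln 2 / (2 * p)\<close>.
\<close>

section \<open>Maximal separated sets\<close>

text \<open>Common form of \<open>sep_along\<close> and \<open>sep_all\<close>, kept literally in
  their shape so that both are instances by unfolding; only the relation \<open>R\<close>
  differs.\<close>

definition max_separated :: "'a set \<Rightarrow> ('a \<Rightarrow> 'a \<Rightarrow> bool) \<Rightarrow> nat" where
  "max_separated X R =
     Max {card K |K. K \<subseteq> X \<and> finite K \<and> (\<forall>x\<in>K. \<forall>y\<in>K. x \<noteq> y \<longrightarrow> R x y)}"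

text \<open>A bound on the cardinalities makes the set under \<open>Max\<close> finite, so that
  \<open>max_separated\<close> is a true maximum.\<close>

definition bounded_separation :: "'a set \<Rightarrow> ('a \<Rightarrow> 'a \<Rightarrow> bool) \<Rightarrow> bool" where
  "bounded_separation X R \<longleftrightarrow>
     (\<exists>N. \<forall>K. K \<subseteq> X \<and> finite K \<and> pairwise R K \<longrightarrow> card K \<le> N)"

lemma card_le_max_separated:
  assumes "bounded_separation X R" "K \<subseteq> X" "finite K" "pairwise R K"
  shows "card K \<le> max_separated X R"
  unfolding max_separated_def
proof (rule Max_ge)
  obtain N where N: "\<And>K. K \<subseteq> X \<Longrightarrow> finite K \<Longrightarrow> pairwise R K \<Longrightarrow> card K \<le> N"
    using assms(1) unfolding bounded_separation_def by blast
  show "finite {card K |K. K \<subseteq> X \<and> finite K \<and> (\<forall>x\<in>K. \<forall>y\<in>K. x \<noteq> y \<longrightarrow> R x y)}"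
    by (rule finite_subset[of _ "{..N}"]) (use N in \<open>auto simp: pairwise_def\<close>)
  show "card K \<in> {card K |K. K \<subseteq> X \<and> finite K \<and> (\<forall>x\<in>K. \<forall>y\<in>K. x \<noteq> y \<longrightarrow> R x y)}"
    using assms(2-4) unfolding pairwise_def by blast
qed

lemma max_separated_attained:
  assumes "bounded_separation X R"
  obtains K where "K \<subseteq> X" "finite K" "pairwise R K" "card K = max_separated X R"
proof -
  let ?C = "{card K |K. K \<subseteq> X \<and> finite K \<and> (\<forall>x\<in>K. \<forall>y\<in>K. x \<noteq> y \<longrightarrow> R x y)}"
  obtain N where N: "\<And>K. K \<subseteq> X \<Longrightarrow> finite K \<Longrightarrow> pairwise R K \<Longrightarrow> card K \<le> N"
    using assms unfolding bounded_separation_def by blast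
  have "finite ?C"
    by (rule finite_subset[of _ "{..N}"]) (use N in \<open>auto simp: pairwise_def\<close>)
  moreover have "?C \<noteq> {}"
    by (auto intro!: exI[of _ "{}"])
  ultimately have "Max ?C \<in> ?C"
    by (rule Max_in)
  then obtain K where "Max ?C = card K" "K \<subseteq> X" "finite K" "\<forall>x\<in>K. \<forall>y\<in>K. x \<noteq> y \<longrightarrow> R x y"
    by blast
  then show thesis
    using that[of K] unfolding pairwise_def max_separated_def by simp
qed

text \<open>Serves two comparisons: decreasing \<epsilon> for a fixed kind of separation, and
  passing from separation along a word to separation by \<open>gen_ball G1 n\<close>.\<close>

lemma max_separated_mono:
  assumes "bounded_separation X R'" "\<And>x y. R x y \<Longrightarrow> R' x y"
  shows "max_separated X R \<le> max_separated X R'"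
proof -
  have pairwise: "pairwise R K \<Longrightarrow> pairwise R' K" for K
    using assms(2) by (simp add: pairwise_def)
  then have "bounded_separation X R"
    using assms(1) unfolding bounded_separation_def by meson
  then obtain K where "K \<subseteq> X" "finite K" "pairwise R K" "card K = max_separated X R"
    by (rule max_separated_attained)
  then show ?thesis
    using card_le_max_separated[OF assms(1), of K] pairwise[of K] by simp
qed

lemma max_separated_ge_1:
  assumes "bounded_separation X R" "a \<in> X"
  shows "1 \<le> max_separated X R"
  using card_le_max_separated[OF assms(1), of "{a}"] assms(2) by simp

text \<open>Finitely many uniformly continuous maps share one modulus \<delta>. Two points in the
  same ball of radius \<open>\<delta> / 2\<close> are then too close to be separated, so a separated
  set injects into the centres of a finite cover.\<close>

lemma bounded_separation_compact:
  fixes F :: "('a::metric_space \<Rightarrow> 'b::metric_space) set"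
  assumes "compact X" "finite F" "\<And>f. f \<in> F \<Longrightarrow> continuous_on X f" "\<epsilon> > 0"
    and R: "\<And>x y. R x y \<Longrightarrow> \<exists>f\<in>F. dist (f x) (f y) \<ge> \<epsilon>"
  shows "bounded_separation X R"
proof -
  have "\<exists>d>0. \<forall>x\<in>X. \<forall>y\<in>X. dist y x < d \<longrightarrow> dist (f y) (f x) < \<epsilon>" if "f \<in> F" for f
    using compact_uniformly_continuous[OF assms(3)[OF that] assms(1)] \<open>\<epsilon> > 0\<close>
    unfolding uniformly_continuous_on_def by blast
  then obtain d where d: "\<And>f. f \<in> F \<Longrightarrow> d f > 0"
    "\<And>f x y. f \<in> F \<Longrightarrow> x \<in> X \<Longrightarrow> y \<in> X \<Longrightarrow> dist y x < d f \<Longrightarrow> dist (f y) (f x) < \<epsilon>"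
    by metis
  \<comment> \<open>Inserting 1 keeps the minimum meaningful when \<open>F\<close> is empty.\<close>
  define \<delta> where "\<delta> = Min (insert 1 (d ` F))"
  have "\<delta> > 0" and \<delta>: "\<And>f. f \<in> F \<Longrightarrow> \<delta> \<le> d f"
    using d(1) \<open>finite F\<close> by (auto simp: \<delta>_def)
  obtain C where C: "finite C" "X \<subseteq> (\<Union>c\<in>C. ball c (\<delta> / 2))"
    using compactE_image[OF \<open>compact X\<close>, of X "\<lambda>c. ball c (\<delta> / 2)"] \<open>\<delta> > 0\<close>
    by (metis UN_I centre_in_ball half_gt_zero open_ball subsetI)
  then obtain c where c: "\<And>x. x \<in> X \<Longrightarrow> c x \<in> C \<and> x \<in> ball (c x) (\<delta> / 2)"
    by (metis UN_E subset_iff)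
  have "card K \<le> card C" if K: "K \<subseteq> X" "pairwise R K" for K
  proof (rule card_inj_on_le[of c])
    show "inj_on c K"
    proof (rule inj_onI, rule ccontr)
      fix x y assume xy: "x \<in> K" "y \<in> K" "c x = c y" "x \<noteq> y"
      obtain f where f: "f \<in> F" "dist (f x) (f y) \<ge> \<epsilon>"
        using R K(2) xy unfolding pairwise_def by metis
      have "dist (c x) x < \<delta> / 2" "dist (c x) y < \<delta> / 2"
        using c[of x] c[of y] xy K(1) by auto
      then have "dist x y < \<delta>"
        by (rule dist_triangle_half_r)
      then show False
        using d(2)[of f y x] \<delta>[OF f(1)] f xy K(1) by auto
    qed
  qed (use c K C in auto)
  then show ?thesis
    unfolding bounded_separation_def by blast
qed

section \<open>Limits\<close>

text \<open>By monotonicity the limit is the supremum over all positive arguments. Hence positivity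
  of an entropy can be checked at a single scale.\<close>

lemma antimono_on_less_Lim_at_right:
  fixes f :: "real \<Rightarrow> ereal"
  assumes mono: "\<And>x y. 0 < x \<Longrightarrow> x \<le> y \<Longrightarrow> f y \<le> f x" and "0 < e" "c < f e"
  shows "c < Lim (at_right 0) f"
proof -
  have "(f \<longlongrightarrow> (SUP x\<in>{0<..}. f x)) (at_right 0)"
  proof (rule order_tendstoI)
    fix a assume "a < (SUP x\<in>{0<..}. f x)"
    then obtain y where "y > 0" "a < f y"
      by (auto simp: less_SUP_iff)
    then show "\<forall>\<^sub>F x in at_right 0. a < f x"
      unfolding eventually_at_right_field using mono less_le_trans by (metis less_imp_le)
  next
    fix a assume "(SUP x\<in>{0<..}. f x) < a"
    then have "f x < a" if "x > 0" for x
      using that by (metis SUP_lessD greaterThan_iff)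
    then show "\<forall>\<^sub>F x in at_right 0. f x < a"
      unfolding eventually_at_right_field by (metis zero_less_one)
  qed
  then have "Lim (at_right 0) f = (SUP x\<in>{0<..}. f x)"
    by (intro tendsto_Lim) auto
  also have "\<dots> \<ge> f e"
    using \<open>0 < e\<close> by (intro SUP_upper) auto
  finally show ?thesis
    using \<open>c < f e\<close> by simp
qed

lemma limsup_ln_pos:
  fixes s :: "nat \<Rightarrow> real"
  assumes "p > 0" "\<And>n. n \<ge> p \<Longrightarrow> 2 ^ (n div p) \<le> s n"
  shows "0 < limsup (\<lambda>n. ereal (1 / real n * ln (s n)))"
proof -
  have "ln 2 / (2 * real p) \<le> 1 / real n * ln (s n)" if "n \<ge> p" for n
  proof -
    have "n div p \<ge> 1"
      using that \<open>p > 0\<close> by (simp add: div_greater_zero_iff Suc_le_eq)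
    have "n < (n div p + 1) * p"
      using \<open>p > 0\<close> dividend_less_div_times[of p n] by (simp add: algebra_simps)
    \<comment> \<open>Since \<open>n div p\<close> is at least 1, the rounding costs at most a
      factor 2; this is the 2 in the rate \<open>ln 2 / (2 * p)\<close>.\<close>
    also have "\<dots> \<le> (2 * (n div p)) * p"
      using \<open>n div p \<ge> 1\<close> by (intro mult_right_mono) auto
    finally have "real n \<le> real (2 * (n div p) * p)"
      by (simp only: of_nat_le_iff)
    then have "1 / (2 * real p) \<le> real (n div p) / real n"
      using that \<open>p > 0\<close> by (simp add: field_simps)
    then have "ln 2 * (1 / (2 * real p)) \<le> ln 2 * (real (n div p) / real n)"
      by (intro mult_left_mono) auto
    also have "\<dots> = 1 / real n * ln (2 ^ (n div p))"
      by (simp add: ln_realpow)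
    also have "\<dots> \<le> 1 / real n * ln (s n)"
      using assms(2)[OF that] by (intro mult_left_mono ln_mono) (auto intro: less_le_trans)
    finally show ?thesis by simp
  qed
  then have "\<forall>\<^sub>F n in sequentially. ereal (ln 2 / (2 * real p)) \<le> ereal (1 / real n * ln (s n))"
    unfolding eventually_sequentially by auto
  then have "ereal (ln 2 / (2 * real p)) \<le> liminf (\<lambda>n. ereal (1 / real n * ln (s n)))"
    by (rule Liminf_bounded)
  also have "\<dots> \<le> limsup (\<lambda>n. ereal (1 / real n * ln (s n)))"
    by (rule Liminf_le_Limsup) simp
  finally show ?thesis
    using \<open>p > 0\<close> by (auto intro: less_le_trans[rotated])
qed

lemma limsup_ln_mono:
  fixes s t :: "nat \<Rightarrow> real"
  assumes "\<And>n. 0 < s n" "\<And>n. s n \<le> t n"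
  shows "limsup (\<lambda>n. ereal (1 / real n * ln (s n))) \<le> limsup (\<lambda>n. ereal (1 / real n * ln (t n)))"
  using assms by (intro Limsup_mono always_eventually allI)
    (auto intro!: divide_right_mono ln_mono intro: less_le_trans)

section \<open>Concatenations\<close>

lemma concat_elem_append: "concat_elem (u @ v) = concat_elem v * concat_elem u"
  by (simp add: concat_elem_def)

lemma finite_concats: "finite A \<Longrightarrow> finite (concats A n)"
  unfolding concats_def by (rule finite_lists_length_eq)

lemma card_concats: "finite A \<Longrightarrow> card (concats A n) = card A ^ n"
  unfolding concats_def by (rule card_lists_length_eq)

text \<open>There are exactly \<open>card A ^ n\<close> words, so a bound valid for every word
  passes to the average under the logarithm in \<open>h_top\<close>.\<close>

lemma average_concats_ge:
  fixes s :: "'g list \<Rightarrow> real"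
  assumes "finite A" "A \<noteq> {}" "\<And>w. w \<in> concats A n \<Longrightarrow> c \<le> s w"
  shows "c \<le> 1 / real (card A) ^ n * (\<Sum>w\<in>concats A n. s w)"
proof -
  have "0 < real (card A) ^ n"
    using assms by (simp add: card_gt_0_iff)
  moreover have "real (card A) ^ n * c \<le> (\<Sum>w\<in>concats A n. s w)"
    using sum_bounded_below[of "concats A n" c s] assms by (simp add: card_concats)
  ultimately show ?thesis
    by (simp add: field_simps)
qed

text \<open>A prefix may be shorter than \<open>n\<close>; padding it with the generator
  \<open>1\<close> restores the length without changing the element.\<close>

lemma concat_elem_take_in_gen_ball:
  assumes "w \<in> concats (G1 - {1}) n" "1 \<in> G1"
  shows "concat_elem (take j w) \<in> gen_ball G1 n"
proof -
  let ?u = "take j w @ replicate (n - length (take j w)) 1"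
  have "?u \<in> concats G1 n"
    using assms set_take_subset[of j w] unfolding concats_def by auto
  moreover have "concat_elem ?u = concat_elem (take j w)"
    by (simp add: concat_elem_def)
  ultimately show ?thesis
    unfolding gen_ball_def by (metis imageI)
qed

text \<open>The identity blocks disappear and consecutive pieces of length \<open>p\<close> join up
  to a prefix of \<open>w\<close>. Blocks are numbered from 1, so the \<open>i\<close>-th piece
  starts at \<open>(i - 1) * p\<close>, and block \<open>Suc j\<close> is preceded by
  \<open>j\<close> pieces.\<close>

lemma transit_pieces:
  "transit (\<lambda>i. concat_elem (take p (drop ((i - 1) * p) w))) (\<lambda>_. [1]) (Suc j)
     = concat_elem (take (j * p) w)"
proof (induction j)
  case 0
  show ?case by (simp add: transit_def concat_elem_def)
next
  case (Suc j)
  have "take (Suc j * p) w = take (j * p) w @ take p (drop (j * p) w)"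
    by (metis add.commute mult_Suc take_add)
  then show ?case
    using Suc by (simp add: transit_def concat_elem_append) (simp add: concat_elem_def)
qed

lemma concat_dist_gt_iff:
  "concat_dist act w x y > \<epsilon> \<longleftrightarrow>
     (\<exists>j\<le>length w. dist (act (concat_elem (take j w)) x) (act (concat_elem (take j w)) y) > \<epsilon>)"
  unfolding concat_dist_def by (subst Max_gr_iff) auto

section \<open>Counting separated points\<close>

lemma bounded_separation_concat_dist:
  assumes "compact X" "continuous_semigroup_action act X" "\<epsilon> > 0"
  shows "bounded_separation X (\<lambda>x y. concat_dist act w x y > \<epsilon>)"
proof (rule bounded_separation_compact[OF assms(1) _ _ assms(3)])
  show "finite ((\<lambda>j. act (concat_elem (take j w))) ` {..length w})" by simp
next
  fix f assume "f \<in> (\<lambda>j. act (concat_elem (take j w))) ` {..length w}"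
  then show "continuous_on X f"
    using assms(2) unfolding continuous_semigroup_action_def by auto
qed (force simp: concat_dist_gt_iff)

lemma bounded_separation_separated_by:
  assumes "compact X" "continuous_semigroup_action act X" "\<epsilon> > 0" "finite G1"
  shows "bounded_separation X (separated_by G1 act n \<epsilon>)"
proof (rule bounded_separation_compact[OF assms(1) _ _ assms(3)])
  show "finite (act ` gen_ball G1 n)"
    unfolding gen_ball_def using assms(4) by (simp add: finite_concats)
next
  fix f assume "f \<in> act ` gen_ball G1 n"
  then show "continuous_on X f"
    using assms(2) unfolding continuous_semigroup_action_def by auto
qed (auto simp: separated_by_def)

lemma sep_along_eq: "sep_along act X w \<epsilon> = max_separated X (\<lambda>x y. concat_dist act w x y > \<epsilon>)"
  unfolding sep_along_def max_separated_def ..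

lemma sep_all_eq: "sep_all G1 act n \<epsilon> X = max_separated X (separated_by G1 act n \<epsilon>)"
  unfolding sep_all_def max_separated_def ..

text \<open>The link between the two entropies: a prefix of \<open>w\<close> that separates two
  points represents an element of \<open>gen_ball G1 n\<close>, and the strict inequality implies
  the weak one.\<close>

lemma sep_along_le_sep_all:
  assumes "compact X" "continuous_semigroup_action act X" "\<epsilon> > 0" "finite G1" "1 \<in> G1"
    and w: "w \<in> concats (G1 - {1}) n"
  shows "sep_along act X w \<epsilon> \<le> sep_all G1 act n \<epsilon> X"
  unfolding sep_along_eq sep_all_eq
proof (rule max_separated_mono)
  show "bounded_separation X (separated_by G1 act n \<epsilon>)"
    by (rule bounded_separation_separated_by) fact+
  fix x y assume "concat_dist act w x y > \<epsilon>"
  then show "separated_by G1 act n \<epsilon> x y"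
    using concat_elem_take_in_gen_ball[OF w \<open>1 \<in> G1\<close>]
    unfolding concat_dist_gt_iff separated_by_def by (meson less_imp_le)
qed

text \<open>A block \<open>[1]\<close> prescribes the orbit at one instant only, while the
  transition elements may be chosen freely among long enough words. The gap \<open>p\<close> depends
  on \<epsilon> alone, not on the word, the itinerary or their lengths.\<close>

lemma specification_shadowing:
  fixes act :: "'g::monoid_mult \<Rightarrow> 'a::metric_space \<Rightarrow> 'a"
  assumes "1 \<in> G1" "continuous_semigroup_action act X"
    and "strong_orbital_specification G1 act X" "\<epsilon> > 0"
  obtains p where "p > 0"
    "\<And>k w xs. k \<ge> 1 \<Longrightarrow> k * p \<le> length w \<Longrightarrow> set w \<subseteq> G1 - {1} \<Longrightarrow> (\<And>j. j < k \<Longrightarrow> xs j \<in> X) \<Longrightarrow>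
       \<exists>x\<in>X. \<forall>j<k. dist (act (concat_elem (take (j * p) w)) x) (xs j) < \<epsilon>"
proof -
  obtain p where "p > 0" and p: "\<And>k q h xs n w.
          k \<ge> (1::nat) \<Longrightarrow>
          (\<forall>j\<in>{1..k}. q j \<ge> p \<and> h j \<in> gen_star G1 (q j)) \<Longrightarrow>
          (\<forall>j\<in>{1..k}. xs j \<in> X) \<Longrightarrow>
          (\<forall>j\<in>{1..k}. n j \<ge> 1 \<and> w j \<in> concats G1 (n j)) \<Longrightarrow>
          (\<exists>x\<in>X. \<forall>j\<in>{1..k}. \<forall>l\<in>{1..n j}.
             dist (act (concat_elem (take l (w j)) * transit h w j) x)
                  (act (concat_elem (take l (w j))) (xs j)) < \<epsilon>)"
    using assms(3)[unfolded strong_orbital_specification_def, rule_format, OF \<open>\<epsilon> > 0\<close>] by blast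
  have "\<exists>x\<in>X. \<forall>j<k. dist (act (concat_elem (take (j * p) w)) x) (xs j) < \<epsilon>"
    if k: "k \<ge> 1" and kp: "k * p \<le> length w" and w: "set w \<subseteq> G1 - {1}"
      and xs: "\<And>j. j < k \<Longrightarrow> xs j \<in> X" for k w xs
  proof -
    define h where "h = (\<lambda>i. concat_elem (take p (drop ((i - 1) * p) w)))"
    \<comment> \<open>Block \<open>k\<close> carries a transition element as well, so
      \<open>k\<close> full pieces must fit into \<open>w\<close>; this is the role of
      \<open>k * p \<le> length w\<close>.\<close>
    have "h j \<in> gen_star G1 p" if "j \<in> {1..k}" for j
    proof -
      have "(j - 1) * p + p = j * p"
        using that by (cases j) auto
      also have "\<dots> \<le> k * p"
        using that by (intro mult_right_mono) auto
      finally have "length (take p (drop ((j - 1) * p) w)) = p"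
        using kp by simp
      then have "take p (drop ((j - 1) * p) w) \<in> concats (G1 - {1}) p"
        using w set_take_subset set_drop_subset unfolding concats_def by fastforce
      then show ?thesis
        unfolding h_def gen_star_def by blast
    qed
    \<comment> \<open>All gaps equal \<open>p\<close> and all blocks have length 1. The shift
      \<open>j - 1\<close> translates between blocks numbered from 1 and itineraries indexed from
      0.\<close>
    then have "\<exists>x\<in>X. \<forall>j\<in>{1..k}. \<forall>l\<in>{1..1}.
        dist (act (concat_elem (take l [1]) * transit h (\<lambda>_. [1]) j) x)
          (act (concat_elem (take l [1])) (xs (j - 1))) < \<epsilon>"
      using k xs \<open>1 \<in> G1\<close> by (intro p[of k "\<lambda>_. p"]) (auto simp: concats_def)
    then obtain x where "x \<in> X" and x: "\<And>j. j \<in> {1..k} \<Longrightarrow>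
        dist (act (concat_elem [1] * transit h (\<lambda>_. [1]) j) x)
          (act (concat_elem [1]) (xs (j - 1))) < \<epsilon>"
      by auto
    have "dist (act (concat_elem (take (j * p) w)) x) (xs j) < \<epsilon>" if "j < k" for j
      using x[of "Suc j"] that xs[OF that] assms(2) transit_pieces[of p w j]
      by (simp add: h_def concat_elem_def[of "[1]"] continuous_semigroup_action_def)
    then show ?thesis
      using \<open>x \<in> X\<close> by blast
  qed
  then show thesis
    using that \<open>p > 0\<close> by blast
qed

text \<open>Each of the \<open>2 ^ (n div p)\<close> codings by \<open>a\<close> and
  \<open>b\<close> has a shadowing point. Two codings differ at some time \<open>j * p\<close>,
  where the points stay within \<epsilon> of \<open>a\<close> and \<open>b\<close> respectively, or
  the reverse.\<close>

lemma exponentially_many_separated: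
  fixes act :: "'g::monoid_mult \<Rightarrow> 'a::metric_space \<Rightarrow> 'a"
  assumes "1 \<in> G1" "compact X" "continuous_semigroup_action act X"
    and "strong_orbital_specification G1 act X" "a \<in> X" "b \<in> X" "\<epsilon> > 0" "3 * \<epsilon> \<le> dist a b"
  obtains p where "p > 0"
    "\<And>n w. n \<ge> p \<Longrightarrow> w \<in> concats (G1 - {1}) n \<Longrightarrow> 2 ^ (n div p) \<le> sep_along act X w \<epsilon>"
proof -
  obtain p where "p > 0" and p:
    "\<And>k w xs. k \<ge> 1 \<Longrightarrow> k * p \<le> length w \<Longrightarrow> set w \<subseteq> G1 - {1} \<Longrightarrow> (\<And>j. j < k \<Longrightarrow> xs j \<in> X) \<Longrightarrow>
       \<exists>x\<in>X. \<forall>j<k. dist (act (concat_elem (take (j * p) w)) x) (xs j) < \<epsilon>"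
    using specification_shadowing[OF assms(1,3,4) \<open>\<epsilon> > 0\<close>] by blast
  have "2 ^ (n div p) \<le> sep_along act X w \<epsilon>"
    if "n \<ge> p" and w: "w \<in> concats (G1 - {1}) n" for n w
  proof -
    define k where "k = n div p"
    have "k \<ge> 1" and kp: "k * p \<le> length w" and "set w \<subseteq> G1 - {1}"
      using that \<open>p > 0\<close> by (auto simp: k_def concats_def div_greater_zero_iff Suc_le_eq)
    \<comment> \<open>Extensional functions are determined by their values below \<open>k\<close>,
      so distinct codings differ there and their number is finite.\<close>
    define I where "I = {..<k} \<rightarrow>\<^sub>E {a, b}"
    have "\<exists>x\<in>X. \<forall>j<k. dist (act (concat_elem (take (j * p) w)) x) (c j) < \<epsilon>" if "c \<in> I" for c
    proof (rule p)
      show "c j \<in> X" if "j < k" for j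
        using \<open>c \<in> I\<close> that PiE_mem[of c "{..<k}" "\<lambda>_. {a, b}" j] assms(5,6) by (auto simp: I_def)
    qed fact+
    then obtain x where xX: "\<And>c. c \<in> I \<Longrightarrow> x c \<in> X" and x: "\<And>c j. c \<in> I \<Longrightarrow> j < k \<Longrightarrow>
        dist (act (concat_elem (take (j * p) w)) (x c)) (c j) < \<epsilon>"
      by metis
    have sep: "concat_dist act w (x c) (x c') > \<epsilon>" if "c \<in> I" "c' \<in> I" "c \<noteq> c'" for c c'
    proof -
      have "\<exists>j\<in>{..<k}. c j \<noteq> c' j"
      proof (rule ccontr)
        assume "\<not> ?thesis"
        then have "c = c'"
          using that(1,2) unfolding I_def by (intro PiE_ext[of c "{..<k}" _ c']) auto
        then show False
          using that(3) by simp
      qed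
      then obtain j where j: "j < k" "c j \<noteq> c' j"
        by auto
      have "c j \<in> {a, b}" "c' j \<in> {a, b}"
        using that j(1) unfolding I_def by (auto dest: PiE_mem)
      then have "dist (c j) (c' j) = dist a b"
        using j(2) by (auto simp: dist_commute)
      let ?y = "act (concat_elem (take (j * p) w)) (x c)"
      let ?y' = "act (concat_elem (take (j * p) w)) (x c')"
      have "dist (c j) (c' j) \<le> dist (c j) ?y + dist ?y ?y' + dist ?y' (c' j)"
        using dist_triangle[of "c j" "c' j" ?y] dist_triangle[of ?y "c' j" ?y'] by linarith
      \<comment> \<open>Two shadowing errors, each strictly below \<epsilon>, are subtracted from at
        least \<open>3 * \<epsilon>\<close>.\<close>
      then have "\<epsilon> < dist ?y ?y'"
        using x[OF that(1) j(1)] x[OF that(2) j(1)] \<open>dist (c j) (c' j) = dist a b\<close> assms(8)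
        by (simp add: dist_commute)
      moreover have "j * p \<le> length w"
        using j(1) kp by (meson le_trans less_imp_le mult_le_mono1)
      ultimately show ?thesis
        unfolding concat_dist_gt_iff by blast
    qed
    have "inj_on x I"
    proof (rule inj_onI, rule ccontr)
      fix c c' assume "c \<in> I" "c' \<in> I" "x c = x c'" "c \<noteq> c'"
      then show False
        using sep[of c c'] \<open>\<epsilon> > 0\<close> by (simp add: concat_dist_gt_iff)
    qed
    moreover have "a \<noteq> b"
      using assms(7,8) by auto
    then have "card I = 2 ^ k"
      by (simp add: I_def card_PiE numeral_2_eq_2)
    ultimately have "card (x ` I) = 2 ^ k"
      by (simp add: card_image)
    moreover have "card (x ` I) \<le> sep_along act X w \<epsilon>"
      unfolding sep_along_eq
    proof (rule card_le_max_separated)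
      show "bounded_separation X (\<lambda>x y. concat_dist act w x y > \<epsilon>)"
        by (rule bounded_separation_concat_dist) fact+
      show "pairwise (\<lambda>x y. concat_dist act w x y > \<epsilon>) (x ` I)"
        using sep by (auto simp: pairwise_def)
      show "x ` I \<subseteq> X"
        using xX by blast
      show "finite (x ` I)"
        by (simp add: I_def finite_PiE)
    qed
    ultimately show ?thesis
      by (simp add: k_def)
  qed
  then show thesis
    using that \<open>p > 0\<close> by blast
qed

text \<open>The nondegeneracy assumptions exclude trivial cases: on a one-point \<open>X\<close>
  both entropies vanish, and for \<open>G1 = {1}\<close> there are no transition elements of
  positive length, so specification would hold vacuously.\<close>

theorem theorem3p4:
  fixes G1 :: "'g::monoid_mult set"
    and act :: "'g \<Rightarrow> 'a::metric_space \<Rightarrow> 'a"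
    and X :: "'a set"
  assumes "finite_generating_set G1"
    and "G1 - {1} \<noteq> {}"
    and "compact X"
    and "\<exists>a\<in>X. \<exists>b\<in>X. a \<noteq> b"
    and "continuous_semigroup_action act X"
    and "strong_orbital_specification G1 act X"
  shows "h_top G1 act X > 0 \<and> h_ent G1 act X > 0"
proof -
  have "finite G1" "1 \<in> G1"
    using assms(1) by (auto simp: finite_generating_set_def)
  obtain a b where ab: "a \<in> X" "b \<in> X" "a \<noteq> b"
    using assms(4) by blast
  define e where "e = dist a b / 3"
  have "e > 0"
    using ab by (simp add: e_def)
  obtain p where "p > 0" and p: "\<And>n w. n \<ge> p \<Longrightarrow> w \<in> concats (G1 - {1}) n \<Longrightarrow>
      2 ^ (n div p) \<le> sep_along act X w e"
    using exponentially_many_separated[OF \<open>1 \<in> G1\<close> assms(3,5,6) ab(1,2) \<open>e > 0\<close>]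
    by (auto simp: e_def)
  \<comment> \<open>Singletons are separated sets. The resulting lower bound 1 keeps the arguments
    of \<open>ln\<close> positive, as its monotonicity requires.\<close>
  have along_ge_1: "1 \<le> real (sep_along act X w \<epsilon>)" if "\<epsilon> > 0" for \<epsilon> w
    using max_separated_ge_1[OF bounded_separation_concat_dist[OF assms(3,5) that] ab(1)]
    by (simp add: sep_along_eq)
  have all_ge_1: "1 \<le> sep_all G1 act n \<epsilon> X" if "\<epsilon> > 0" for \<epsilon> n
    using max_separated_ge_1[OF bounded_separation_separated_by[OF assms(3,5) that \<open>finite G1\<close>] ab(1)]
    by (simp add: sep_all_eq)
  have "h_top G1 act X > 0"
    unfolding h_top_def
  proof (rule antimono_on_less_Lim_at_right[OF _ \<open>e > 0\<close>])
    fix x y :: real assume xy: "0 < x" "x \<le> y"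
    have "sep_along act X w y \<le> sep_along act X w x" for w
      unfolding sep_along_eq
      by (rule max_separated_mono[OF bounded_separation_concat_dist[OF assms(3,5) xy(1)]])
        (use xy in auto)
    moreover have "1 \<le> 1 / real (card (G1 - {1})) ^ n *
        (\<Sum>w\<in>concats (G1 - {1}) n. real (sep_along act X w y))" for n
      using \<open>finite G1\<close> assms(2) along_ge_1 xy by (intro average_concats_ge) auto
    ultimately show "limsup (\<lambda>n. ereal (1 / real n * ln (1 / real (card (G1 - {1})) ^ n *
          (\<Sum>w\<in>concats (G1 - {1}) n. real (sep_along act X w y)))))
        \<le> limsup (\<lambda>n. ereal (1 / real n * ln (1 / real (card (G1 - {1})) ^ n *
          (\<Sum>w\<in>concats (G1 - {1}) n. real (sep_along act X w x)))))"
      by (intro limsup_ln_mono mult_left_mono sum_mono) (auto intro: less_le_trans[OF zero_less_one])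
  next
    show "0 < limsup (\<lambda>n. ereal (1 / real n * ln (1 / real (card (G1 - {1})) ^ n *
          (\<Sum>w\<in>concats (G1 - {1}) n. real (sep_along act X w e)))))"
    \<comment> \<open>The same \<open>p\<close> works for every word of length \<open>n\<close>, so
      the exponential bound survives averaging.\<close>
    proof (rule limsup_ln_pos[OF \<open>p > 0\<close>], rule average_concats_ge)
      fix n w assume "n \<ge> p" "w \<in> concats (G1 - {1}) n"
      from p[OF this] show "2 ^ (n div p) \<le> real (sep_along act X w e)"
        by (metis of_nat_le_iff of_nat_numeral of_nat_power)
    qed (use \<open>finite G1\<close> assms(2) in auto)
  qed
  moreover have "h_ent G1 act X > 0"
    unfolding h_ent_def
  proof (rule antimono_on_less_Lim_at_right[OF _ \<open>e > 0\<close>])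
    fix x y :: real assume xy: "0 < x" "x \<le> y"
    have "sep_all G1 act n y X \<le> sep_all G1 act n x X" for n
      unfolding sep_all_eq
      by (rule max_separated_mono[OF bounded_separation_separated_by[OF assms(3,5) xy(1) \<open>finite G1\<close>]])
        (use xy in \<open>auto simp: separated_by_def intro: order_trans\<close>)
    moreover have "0 < sep_all G1 act n y X" for n
      using all_ge_1[of y n] xy by simp
    ultimately show "limsup (\<lambda>n. ereal (1 / real n * ln (real (sep_all G1 act n y X))))
        \<le> limsup (\<lambda>n. ereal (1 / real n * ln (real (sep_all G1 act n x X))))"
      by (intro limsup_ln_mono) auto
  next
    show "0 < limsup (\<lambda>n. ereal (1 / real n * ln (real (sep_all G1 act n e X))))"
    proof (rule limsup_ln_pos[OF \<open>p > 0\<close>])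
      fix n assume "n \<ge> p"
      \<comment> \<open>For this entropy a single word of each length suffices; a constant one is
        available once there is a generator other than the identity.\<close>
      obtain g where "g \<in> G1 - {1}"
        using assms(2) by blast
      then have w: "replicate n g \<in> concats (G1 - {1}) n"
        by (auto simp: concats_def)
      have "2 ^ (n div p) \<le> sep_all G1 act n e X"
        using p[OF \<open>n \<ge> p\<close> w]
          sep_along_le_sep_all[OF assms(3,5) \<open>e > 0\<close> \<open>finite G1\<close> \<open>1 \<in> G1\<close> w] by simp
      then show "2 ^ (n div p) \<le> real (sep_all G1 act n e X)"
        by (metis of_nat_le_iff of_nat_numeral of_nat_power)
    qed
  qed
  ultimately show ?thesis ..
qed

end
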